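(* Let $n,d,L,k$ be positive integers, let $\mathbf{x}_1,\dots,\mathbf{x}_n\in\mathbb{R}^d$, let $Y=[\mathbf{y}_1,\dots,\mathbf{y}_n]\in\{-1,1\}^{L\times n}$ (with columns $\mathbf{y}_j\in\{-1,1\}^L$), and for $i\in\{1,\dots,L\}$, $j\in\{1,\dots,n\}$ let $\tilde{\mathbf{y}}_{i,j}\in\mathbb{R}^L$ be the vector obtained from $\mathbf{y}_j$ by replacing its $i$-th entry with $0$. Let $\gamma_1>0$, $\gamma_2>0$, $C>0$ be arbitrary real numbers. (a) For every fixed matrix $D\in\mathbb{R}^{k\times d}$ and every $i\in\{1,\dots,L\}$, the solution of the optimization problem $$\min_{w_i\in\mathbb{R}^k,\ \tilde w_i\in\mathbb{R}^L}\ \frac12\left(\gamma_1\|w_i\|_2^2+\gamma_2\|\tilde w_i\|_2^2\right)+C\sum_{j=1}^n\langle\tilde w_i,\tilde{\mathbf{y}}_{i,j}\rangle$$ subject to $$Y_{ij}\langle w_i,D\mathbf{x}_j\rangle\ge 1-\langle\tilde w_i,\tilde{\mathbf{y}}_{i,j}\rangle,\qquad \langle\tilde w_i,\tilde{\mathbf{y}}_{i,j}\rangle\ge 0\qquad\text{for all } j=1,\dots,n,$$ is unique; that is, any two optimal solutions $(w_i,\tilde w_i)$ coincide. (b) For every fixed matrix $W=[w_1,\dots,w_L]\in\mathbb{R}^{k\times L}$, the solution of the optimization problem $$\min_{D\in\mathbb{R}^{k\times d},\ \tilde W=[\tilde w_1,\dots,\tilde w_L]\in\mathbb{R}^{L\times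 L}}\ \frac12\|D\|_F^2+\frac{\gamma_2}{2}\sum_{i=1}^L\|\tilde w_i\|_2^2+C\sum_{i=1}^L\sum_{j=1}^n\langle\tilde w_i,\tilde{\mathbf{y}}_{i,j}\rangle$$ subject to $$Y_{ij}\langle D,w_i\mathbf{x}_j^T\rangle\ge 1-\langle\tilde w_i,\tilde{\mathbf{y}}_{i,j}\rangle,\qquad \langle\tilde w_i,\tilde{\mathbf{y}}_{i,j}\rangle\ge 0\qquad\text{for all } i=1,\dots,L,\ j=1,\dots,n,$$ is unique; that is, any two optimal solutions $(D,\tilde W)$ coincide.
   Context: $\langle\cdot,\cdot\rangle$ denotes the standard inner product of two vectors, or the Frobenius inner product $\langle A,B\rangle=\operatorname{tr}(A^TB)$ of two matrices of the same size; $\|\cdot\|_2$ is the Euclidean norm and $\|\cdot\|_F$ the Frobenius norm. $Y_{ij}$ is the $(i,j)$ entry of $Y$, i.e. the $i$-th entry of $\mathbf{y}_j$. An optimal solution of a minimization problem is a feasible point (one satisfying all constraints) at which the objective attains its minimum over the feasible set. *)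

theory Defs
  imports "HOL-Analysis.Analysis"
begin

definition frob_inner :: "real^'n^'m \<Rightarrow> real^'n^'m \<Rightarrow> real" where
  "frob_inner A B = trace (transpose A ** B)"

definition frob_norm :: "real^'n^'m \<Rightarrow> real" where
  "frob_norm A = sqrt (frob_inner A A)"

lemma frob_inner_eq_inner: "frob_inner A B = A \<bullet> B"
proof -
  have "frob_inner A B = (\<Sum>j\<in>UNIV. \<Sum>i\<in>UNIV. A $ i $ j * B $ i $ j)"
    by (simp add: frob_inner_def trace_def transpose_def matrix_matrix_mult_def)
  also have "\<dots> = (\<Sum>i\<in>UNIV. \<Sum>j\<in>UNIV. A $ i $ j * B $ i $ j)"
    by (rule sum.swap)
  also have "\<dots> = A \<bullet> B"
    by (simp add: inner_vec_def)
  finally show ?thesis .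
qed

lemma frob_norm_eq_norm: "frob_norm A = norm A"
  by (simp add: frob_norm_def frob_inner_eq_inner norm_eq_sqrt_inner)

definition outer_product :: "real^'k \<Rightarrow> real^'d \<Rightarrow> real^'d^'k" where
  "outer_product w x = (columnvector w :: real^1^'k) ** rowvector x"

definition y_masked :: "real^'n^'L \<Rightarrow> 'L \<Rightarrow> 'n \<Rightarrow> real^'L" where
  "y_masked Y i j = (\<chi> m. if m = i then 0 else column j Y $ m)"

text \<open>The cardinalities of the index types are the dimensions: \<open>'n\<close> indexes the samples,
  \<open>'d\<close> the features, \<open>'L\<close> the labels and \<open>'k\<close> the rows of the dictionary. The unknowns of each
  problem are collected in a pair.\<close>

definition label_objective ::
    "real \<Rightarrow> real \<Rightarrow> real \<Rightarrow> real^'n^'L \<Rightarrow> 'L \<Rightarrow> (real^'k) \<times> (real^'L) \<Rightarrow> real" where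
  "label_objective \<gamma>1 \<gamma>2 C Y i = (\<lambda>(w, wt).
     1 / 2 * (\<gamma>1 * (norm w)\<^sup>2 + \<gamma>2 * (norm wt)\<^sup>2) + C * (\<Sum>j\<in>UNIV. wt \<bullet> y_masked Y i j))"

definition label_feasible ::
    "('n \<Rightarrow> real^'d) \<Rightarrow> real^'n^'L \<Rightarrow> real^'d^'k \<Rightarrow> 'L \<Rightarrow> (real^'k) \<times> (real^'L) \<Rightarrow> bool" where
  "label_feasible x Y D i = (\<lambda>(w, wt). \<forall>j.
     Y $ i $ j * (w \<bullet> (D *v x j)) \<ge> 1 - wt \<bullet> y_masked Y i j \<and> wt \<bullet> y_masked Y i j \<ge> 0)"

definition dict_objective ::
    "real \<Rightarrow> real \<Rightarrow> real^'n^'L \<Rightarrow> (real^'d^'k) \<times> (real^'L^'L) \<Rightarrow> real" where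
  "dict_objective \<gamma>2 C Y = (\<lambda>(D, Wt).
     1 / 2 * (frob_norm D)\<^sup>2 + \<gamma>2 / 2 * (\<Sum>i\<in>UNIV. (norm (column i Wt))\<^sup>2)
     + C * (\<Sum>i\<in>UNIV. \<Sum>j\<in>UNIV. column i Wt \<bullet> y_masked Y i j))"

definition dict_feasible ::
    "('n \<Rightarrow> real^'d) \<Rightarrow> real^'n^'L \<Rightarrow> real^'L^'k \<Rightarrow> (real^'d^'k) \<times> (real^'L^'L) \<Rightarrow> bool" where
  "dict_feasible x Y W = (\<lambda>(D, Wt). \<forall>i j.
     Y $ i $ j * frob_inner D (outer_product (column i W) (x j)) \<ge> 1 - column i Wt \<bullet> y_masked Y i j
     \<and> column i Wt \<bullet> y_masked Y i j \<ge> 0)"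

end

(* Both objectives are a positive definite quadratic form plus a linear form, and both
   feasible sets are cut out by affine inequalities. By the parallelogram law, the midpoint of two
   distinct optimal solutions would be feasible with a strictly smaller objective. *)
theory Submission
  imports Defs
begin

text \<open>Neither minimum value can exceed the value at a feasible midpoint, so their average
  cannot either, against \<open>strict\<close>. Both closure and strictness are asked only at the
  given pair.\<close>

lemma is_arg_min_unique_midpoint:
  fixes f :: "'a::real_vector \<Rightarrow> real"
  assumes "is_arg_min f P p" "is_arg_min f P q"
    and feasible: "P p \<Longrightarrow> P q \<Longrightarrow> P (midpoint p q)"
    and strict: "p \<noteq> q \<Longrightarrow> f (midpoint p q) < (f p + f q) / 2"
  shows "p = q"
proof (rule ccontr)
  assume "p \<noteq> q"
  then have "f (midpoint p q) < (f p + f q) / 2" by (rule strict)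
  moreover have "f p \<le> f (midpoint p q)" "f q \<le> f (midpoint p q)"
    using assms(1-2) feasible by (auto simp: is_arg_min_linorder)
  ultimately show False by (simp add: field_simps)
qed

text \<open>Parallelogram law. The subtracted term is the gain in strictness: it vanishes only for
  \<open>a = b\<close>.\<close>

lemma norm_midpoint_squared:
  fixes a b :: "'a::real_inner"
  shows "(norm (midpoint a b))\<^sup>2 = ((norm a)\<^sup>2 + (norm b)\<^sup>2) / 2 - (norm (a - b))\<^sup>2 / 4"
proof -
  have "(norm (midpoint a b))\<^sup>2 = (a + b) \<bullet> (a + b) / 4"
    by (simp add: midpoint_def power_divide flip: power2_norm_eq_inner)
  also have "\<dots> = (a \<bullet> a + b \<bullet> b) / 2 - (a - b) \<bullet> (a - b) / 4"
    by (simp add: inner_add_left inner_add_right inner_diff_left inner_diff_right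
        inner_commute[of b a] field_simps)
  finally show ?thesis by (simp add: power2_norm_eq_inner)
qed

lemma inner_midpoint_left:
  fixes a b c :: "'a::real_inner"
  shows "midpoint a b \<bullet> c = (a \<bullet> c + b \<bullet> c) / 2"
  by (simp add: midpoint_def algebra_simps)

lemma midpoint_Pair: "midpoint (a, b) (c, d) = (midpoint a c, midpoint b d)"
  by (simp add: midpoint_def)

lemma column_midpoint: "column i (midpoint A B :: real^'n^'m) = midpoint (column i A) (column i B)"
  by (simp add: vec_eq_iff column_def midpoint_def)

text \<open>Needed because the dictionary objective measures \<open>Wt\<close> column by
  column.\<close>

lemma matrix_eq_iff_columns: "A = B \<longleftrightarrow> (\<forall>i. column i A = column i B)"
  by (auto simp: vec_eq_iff column_def)

text \<open>The linear term with factor \<open>C\<close> averages exactly, so only the quadratic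
  part leaves a defect; 1/8 is the 1/2 of the objective times the 1/4 of the parallelogram
  law.\<close>

lemma label_objective_midpoint:
  "label_objective \<gamma>1 \<gamma>2 C Y i (midpoint (w, wt) (w', wt'))
   = (label_objective \<gamma>1 \<gamma>2 C Y i (w, wt) + label_objective \<gamma>1 \<gamma>2 C Y i (w', wt')) / 2
     - (\<gamma>1 * (norm (w - w'))\<^sup>2 + \<gamma>2 * (norm (wt - wt'))\<^sup>2) / 8"
  by (simp add: label_objective_def midpoint_Pair norm_midpoint_squared inner_midpoint_left
      sum.distrib sum_divide_distrib[symmetric] field_simps)

text \<open>For fixed \<open>D\<close> each constraint is affine in \<open>(w, wt)\<close>, so at
  the midpoint it is the average of the constraints at \<open>p\<close> and
  \<open>q\<close>.\<close>

lemma label_feasible_midpoint: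
  assumes "label_feasible x Y D i p" "label_feasible x Y D i q"
  shows "label_feasible x Y D i (midpoint p q)"
proof -
  obtain w wt w' wt' where [simp]: "p = (w, wt)" "q = (w', wt')" by fastforce
  have "Y $ i $ j * (midpoint w w' \<bullet> (D *v x j)) \<ge> 1 - midpoint wt wt' \<bullet> y_masked Y i j
      \<and> midpoint wt wt' \<bullet> y_masked Y i j \<ge> 0" for j
    using assms[unfolded label_feasible_def, simplified, rule_format, of j]
    by (simp add: inner_midpoint_left field_simps)
  then show ?thesis by (simp add: label_feasible_def midpoint_Pair)
qed

text \<open>The Frobenius norm is the Euclidean norm of the matrix, so the parallelogram law applies
  to \<open>D\<close> just as to the columns of \<open>Wt\<close>.\<close>

lemma dict_objective_midpoint:
  "dict_objective \<gamma>2 C Y (midpoint (D, Wt) (D', Wt'))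
   = (dict_objective \<gamma>2 C Y (D, Wt) + dict_objective \<gamma>2 C Y (D', Wt')) / 2
     - ((norm (D - D'))\<^sup>2 + \<gamma>2 * (\<Sum>i\<in>UNIV. (norm (column i Wt - column i Wt'))\<^sup>2)) / 8"
proof -
  have norms: "(\<Sum>i\<in>UNIV. (norm (column i (midpoint Wt Wt')))\<^sup>2)
      = ((\<Sum>i\<in>UNIV. (norm (column i Wt))\<^sup>2) + (\<Sum>i\<in>UNIV. (norm (column i Wt'))\<^sup>2)) / 2
        - (\<Sum>i\<in>UNIV. (norm (column i Wt - column i Wt'))\<^sup>2) / 4"
    by (simp add: column_midpoint norm_midpoint_squared sum.distrib sum_subtractf
        flip: sum_divide_distrib)
  have masked: "(\<Sum>i\<in>UNIV. \<Sum>j\<in>UNIV. column i (midpoint Wt Wt') \<bullet> y_masked Y i j)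
      = ((\<Sum>i\<in>UNIV. \<Sum>j\<in>UNIV. column i Wt \<bullet> y_masked Y i j)
        + (\<Sum>i\<in>UNIV. \<Sum>j\<in>UNIV. column i Wt' \<bullet> y_masked Y i j)) / 2"
    by (simp add: column_midpoint inner_midpoint_left sum.distrib flip: sum_divide_distrib)
  show ?thesis
    by (simp add: dict_objective_def frob_norm_eq_norm midpoint_Pair norm_midpoint_squared
        norms masked add_divide_distrib diff_divide_distrib algebra_simps)
qed

text \<open>With \<open>W\<close> fixed, \<open>D\<close> enters through an inner product with a
  constant matrix, so the constraints are jointly affine in \<open>(D, Wt)\<close> and the outer
  product can stay folded.\<close>

lemma dict_feasible_midpoint:
  assumes "dict_feasible x Y W p" "dict_feasible x Y W q"
  shows "dict_feasible x Y W (midpoint p q)"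
proof -
  obtain D Wt D' Wt' where [simp]: "p = (D, Wt)" "q = (D', Wt')" by fastforce
  have "Y $ i $ j * frob_inner (midpoint D D') (outer_product (column i W) (x j))
        \<ge> 1 - column i (midpoint Wt Wt') \<bullet> y_masked Y i j
      \<and> column i (midpoint Wt Wt') \<bullet> y_masked Y i j \<ge> 0" for i j
    using assms[unfolded dict_feasible_def, simplified, rule_format, of i j]
    by (simp add: frob_inner_eq_inner column_midpoint inner_midpoint_left field_simps)
  then show ?thesis by (simp add: dict_feasible_def midpoint_Pair)
qed

lemma label_arg_min_unique:
  assumes "\<gamma>1 > 0" "\<gamma>2 > 0"
    and "is_arg_min (label_objective \<gamma>1 \<gamma>2 C Y i) (label_feasible x Y D i) p"
    and "is_arg_min (label_objective \<gamma>1 \<gamma>2 C Y i) (label_feasible x Y D i) q"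
  shows "p = q"
  using assms(3,4) label_feasible_midpoint
\<comment> \<open>The chained facts discharge optimality and closure under midpoints; the strict
  inequality remains.\<close>
proof (rule is_arg_min_unique_midpoint)
  assume "p \<noteq> q"
  obtain w wt w' wt' where pq: "p = (w, wt)" "q = (w', wt')" by fastforce
  \<comment> \<open>The pairs differ in some component, and both weights are positive.\<close>
  have "\<gamma>1 * (norm (w - w'))\<^sup>2 + \<gamma>2 * (norm (wt - wt'))\<^sup>2 > 0"
    using \<open>p \<noteq> q\<close> pq assms(1,2) by (auto intro: add_pos_nonneg add_nonneg_pos)
  then show "label_objective \<gamma>1 \<gamma>2 C Y i (midpoint p q)
      < (label_objective \<gamma>1 \<gamma>2 C Y i p + label_objective \<gamma>1 \<gamma>2 C Y i q) / 2"
    unfolding pq label_objective_midpoint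
    \<comment> \<open>The goal has the form \<open>A - d / 8 < A\<close>; these rules reduce it to
      \<open>0 < d\<close> and leave the average \<open>A\<close> untouched.\<close>
    by (simp only: diff_less_eq less_add_same_cancel1 zero_less_divide_iff zero_less_numeral simp_thms)
qed

lemma dict_arg_min_unique:
  assumes "\<gamma>2 > 0"
    and "is_arg_min (dict_objective \<gamma>2 C Y) (dict_feasible x Y W) p"
    and "is_arg_min (dict_objective \<gamma>2 C Y) (dict_feasible x Y W) q"
  shows "p = q"
  using assms(2,3) dict_feasible_midpoint
proof (rule is_arg_min_unique_midpoint)
  assume "p \<noteq> q"
  obtain D Wt D' Wt' where pq: "p = (D, Wt)" "q = (D', Wt')" by fastforce
  let ?S = "\<Sum>i\<in>UNIV. (norm (column i Wt - column i Wt'))\<^sup>2"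
  have "?S \<ge> 0" by (simp add: sum_nonneg)
  moreover have "?S = 0 \<longleftrightarrow> Wt = Wt'"
    by (simp add: sum_nonneg_eq_0_iff matrix_eq_iff_columns)
  ultimately have "(norm (D - D'))\<^sup>2 + \<gamma>2 * ?S > 0"
    using \<open>p \<noteq> q\<close> pq assms(1)
    \<comment> \<open>If \<open>D = D'\<close>, then \<open>Wt\<close> and \<open>Wt'\<close> differ
      and \<open>?S\<close> is positive; otherwise the first square is.\<close>
    by (cases "D = D'") (auto intro!: add_pos_nonneg mult_pos_pos)
  then show "dict_objective \<gamma>2 C Y (midpoint p q)
      < (dict_objective \<gamma>2 C Y p + dict_objective \<gamma>2 C Y q) / 2"
    unfolding pq dict_objective_midpoint
    by (simp only: diff_less_eq less_add_same_cancel1 zero_less_divide_iff zero_less_numeral simp_thms)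
qed

theorem theorem1:
  fixes x :: "'n::finite \<Rightarrow> real^'d::finite"
    and Y :: "real^'n^'L::finite"
    and \<gamma>1 \<gamma>2 C :: real
  assumes "\<forall>i j. Y $ i $ j \<in> {-1, 1}"
    and "\<gamma>1 > 0" and "\<gamma>2 > 0" and "C > 0"
  shows "(\<forall>(D :: real^'d^'k::finite) (i :: 'L) p q.
            is_arg_min (label_objective \<gamma>1 \<gamma>2 C Y i) (label_feasible x Y D i) p \<longrightarrow>
            is_arg_min (label_objective \<gamma>1 \<gamma>2 C Y i) (label_feasible x Y D i) q \<longrightarrow> p = q)
       \<and> (\<forall>(W :: real^'L^'k) p q.
            is_arg_min (dict_objective \<gamma>2 C Y) (dict_feasible x Y W) p \<longrightarrow>
            is_arg_min (dict_objective \<gamma>2 C Y) (dict_feasible x Y W) q \<longrightarrow> p = q)"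
  using assms(2,3) label_arg_min_unique dict_arg_min_unique by blast

end
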